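(* Let $G$ be a finite simple graph that has an edge dominating trail. Then $$\gamma_{e,g}(G)\le \left\lceil \frac{m(G)}{2}\right\rceil.$$
   Context: All graphs are finite, simple and undirected; $m(G)$ is the number of edges of $G$. A trail is a walk $v_0v_1\dots v_\ell$ (open or closed) with no repeated edge (vertices may repeat). It is an edge dominating trail of $G$ if its vertex set $\{v_0,\dots,v_\ell\}$ is a vertex cover of $G$, i.e. $e\cap\{v_0,\dots,v_\ell\}\neq\emptyset$ for every $e\in E(G)$. For an edge $e\in E(G)$, its closed neighborhood is $N_G[e]=\{f\in E(G): e\cap f\neq\emptyset\}$ (so $e\in N_G[e]$); $e$ dominates exactly the edges of $N_G[e]$. A set $D\subseteq E(G)$ is an edge dominating set if $\bigcup_{e\in D}N_G[e]=E(G)$. Edge domination game: two players, Dominator and Staller, take turns choosing an edge of $G$; choosing $e$ is legal if and only if $N_G[e]$ contains at least one edge not dominated by the previously chosen edges. The game finishes when the set of chosen edges is an edge dominating set of $G$. Dominator wants to minimize the total number of chosen edges, Staller wants to maximize it. The game edge domination number $\gamma_{e,g}(G)$ is the total number of edges chosen (by both players) when Dominator moves first and both play optimally. *)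

theory Defs
  imports Complex_Main
begin

definition simple_graph :: "'a set \<Rightarrow> 'a set set \<Rightarrow> bool" where
  "simple_graph V E \<longleftrightarrow> finite V \<and> (\<forall>e\<in>E. e \<subseteq> V \<and> card e = 2)"

text \<open>Walks are given by their nonempty vertex sequence, so a single vertex is a (closed)
  trail of length 0.\<close>

fun walk_edges :: "'a list \<Rightarrow> 'a set list" where
  "walk_edges (u # v # vs) = {u, v} # walk_edges (v # vs)"
| "walk_edges _ = []"

definition trail :: "'a set \<Rightarrow> 'a set set \<Rightarrow> 'a list \<Rightarrow> bool" where
  "trail V E vs \<longleftrightarrow> vs \<noteq> [] \<and> set vs \<subseteq> V \<and> set (walk_edges vs) \<subseteq> E \<and> distinct (walk_edges vs)"

definition vertex_cover :: "'a set \<Rightarrow> 'a set set \<Rightarrow> 'a set \<Rightarrow> bool" where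
  "vertex_cover V E C \<longleftrightarrow> C \<subseteq> V \<and> (\<forall>e\<in>E. e \<inter> C \<noteq> {})"

definition edge_dominating_trail :: "'a set \<Rightarrow> 'a set set \<Rightarrow> 'a list \<Rightarrow> bool" where
  "edge_dominating_trail V E vs \<longleftrightarrow> trail V E vs \<and> vertex_cover V E (set vs)"

definition closed_edge_nbhd :: "'a set set \<Rightarrow> 'a set \<Rightarrow> 'a set set" where
  "closed_edge_nbhd E e = {f \<in> E. e \<inter> f \<noteq> {}}"

definition dominated_edges :: "'a set set \<Rightarrow> 'a set set \<Rightarrow> 'a set set" where
  "dominated_edges E D = (\<Union>e\<in>D. closed_edge_nbhd E e)"

definition edge_dominating_set :: "'a set set \<Rightarrow> 'a set set \<Rightarrow> bool" where
  "edge_dominating_set E D \<longleftrightarrow> D \<subseteq> E \<and> dominated_edges E D = E"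

definition legal_moves :: "'a set set \<Rightarrow> 'a set set \<Rightarrow> 'a set set" where
  "legal_moves E D = {e \<in> E. \<exists>f \<in> closed_edge_nbhd E e. f \<notin> dominated_edges E D}"

lemma legal_move_decreases:
  assumes "finite E" "e \<in> legal_moves E D"
  shows "card (E - insert e D) < card (E - D)"
proof (rule psubset_card_mono)
  have "e \<in> E - D"
    using assms(2) by (auto simp: legal_moves_def dominated_edges_def)
  then show "E - insert e D \<subset> E - D" by blast
qed (use assms(1) in simp)

lemma legal_moves_nonempty:
  assumes "{} \<notin> E" "D \<subseteq> E" "\<not> edge_dominating_set E D"
  shows "legal_moves E D \<noteq> {}"
proof -
  have "dominated_edges E D \<subseteq> E"
    by (auto simp: dominated_edges_def closed_edge_nbhd_def)
  with assms(2,3) obtain f where f: "f \<in> E" "f \<notin> dominated_edges E D"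
    unfolding edge_dominating_set_def by blast
  moreover have "f \<in> closed_edge_nbhd E f"
    using assms(1) f(1) by (auto simp: closed_edge_nbhd_def)
  ultimately show ?thesis by (auto simp: legal_moves_def)
qed

datatype player = Dominator | Staller

fun opponent :: "player \<Rightarrow> player" where
  "opponent Dominator = Staller"
| "opponent Staller = Dominator"

text \<open>\<open>remaining_moves E p D\<close> is the number of edges still to be chosen under optimal play when the
  edges in \<open>D\<close> have been chosen and player \<open>p\<close> is to move (backward induction). The disjuncts
  other than the finishing condition only make the recursion total: they never apply to an unfinished
  position of the game on a finite simple graph, by \<open>legal_moves_nonempty\<close>, so \<open>Min\<close> and \<open>Max\<close>
  are taken over finite nonempty sets.\<close>

function remaining_moves :: "'a set set \<Rightarrow> player \<Rightarrow> 'a set set \<Rightarrow> nat" where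
  "remaining_moves E p D =
    (if edge_dominating_set E D \<or> infinite E \<or> legal_moves E D = {} then 0
     else 1 + (case p of
         Dominator \<Rightarrow> Min ((\<lambda>e. remaining_moves E (opponent p) (insert e D)) ` legal_moves E D)
       | Staller \<Rightarrow> Max ((\<lambda>e. remaining_moves E (opponent p) (insert e D)) ` legal_moves E D)))"
  by pat_completeness auto
termination
  by (relation "measure (\<lambda>(E, p, D). card (E - D))") (auto intro: legal_move_decreases)

declare remaining_moves.simps [simp del]

definition game_edge_domination_number :: "'a set set \<Rightarrow> nat" where
  "game_edge_domination_number E = remaining_moves E Dominator {}"

end

theory Submission imports Defs begin

text \<open>Let \<open>F\<close> be the set of undominated edges and consider the potential \<open>|F| + c\<close>, where \<open>c\<close> is
  the number of components of \<open>F\<close>. A move hitting \<open>d\<close> edges of \<open>F\<close> leaves at most \<open>d\<close>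
  components in place of one, so it lowers the potential by at least 1, and by at least 2 if \<open>F\<close> is a matching.
  If \<open>F\<close> is not a matching, let \<open>v\<^sub>0 v\<^sub>1 v\<^sub>2 \<dots>\<close> be a longest path in \<open>F\<close>. Dominator chooses
  \<open>v\<^sub>1 v\<^sub>2\<close>: neither this edge nor \<open>v\<^sub>0 v\<^sub>1\<close> leads to a component of its own, since \<open>v\<^sub>0\<close> becomes
  isolated or stays joined to \<open>v\<^sub>3\<close>, and the potential drops by at least 3. So two consecutive
  moves lower the potential by at least 4, and it starts at \<open>m + 1\<close> or less because the edge dominating
  trail makes the edges of \<open>G\<close> connected.\<close>

section \<open>Labellings, components and the potential\<close>

definition edge_constant :: "'a set set \<Rightarrow> ('a \<Rightarrow> nat) \<Rightarrow> bool" where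
  "edge_constant F g \<longleftrightarrow> (\<forall>e\<in>F. \<forall>x\<in>e. \<forall>y\<in>e. g x = g y)"

text \<open>The number of components is encoded as the largest number of labels in a vertex labelling that
  is constant on every edge; isolated vertices do not count.\<close>

definition num_components :: "'a set set \<Rightarrow> nat" where
  "num_components F = Max {card (g ` \<Union>F) | g. edge_constant F g}"

definition potential :: "'a set set \<Rightarrow> nat" where
  "potential F = card F + num_components F"

text \<open>The set \<open>e\<close> need not belong to \<open>F\<close>: a player may legally
  choose an edge that is already dominated.\<close>

definition missed :: "'a set set \<Rightarrow> 'a set \<Rightarrow> 'a set set" where
  "missed F e = {f \<in> F. f \<inter> e = {}}"

definition hit :: "'a set set \<Rightarrow> 'a set \<Rightarrow> 'a set set" where
  "hit F e = {f \<in> F. f \<inter> e \<noteq> {}}"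

definition undominated :: "'a set set \<Rightarrow> 'a set set \<Rightarrow> 'a set set" where
  "undominated E D = {f \<in> E. \<forall>e\<in>D. f \<inter> e = {}}"

lemma undominated_insert: "undominated E (insert e D) = missed (undominated E D) e"
  by (auto simp: undominated_def missed_def)

lemma legal_moves_iff_hit: "e \<in> legal_moves E D \<longleftrightarrow> e \<in> E \<and> hit (undominated E D) e \<noteq> {}"
  by (auto simp: legal_moves_def closed_edge_nbhd_def dominated_edges_def undominated_def hit_def
      Int_commute)

lemma finite_hit: "finite (\<Union>F) \<Longrightarrow> finite (hit F e)"
  by (rule finite_subset[of _ F]) (auto simp: hit_def intro: finite_UnionD)

lemma edge_constantD: "edge_constant F g \<Longrightarrow> e \<in> F \<Longrightarrow> x \<in> e \<Longrightarrow> y \<in> e \<Longrightarrow> g x = g y"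
  unfolding edge_constant_def by blast

lemma edge_constant_walk:
  assumes "edge_constant F g" "set (walk_edges ws) \<subseteq> F" "x \<in> set ws"
  shows "g x = g (hd ws)"
  using assms(2,3)
proof (induction ws rule: walk_edges.induct)
  case (1 u v vs)
  have "g u = g v"
    using edge_constantD[OF assms(1), of "{u, v}"] "1.prems" by auto
  with 1 show ?case by auto
qed auto

lemma finite_label_counts:
  assumes "finite (\<Union>F)"
  shows "finite {card (g ` \<Union>F) | g. edge_constant F g}"
  by (rule finite_subset[of _ "{..card (\<Union>F)}"]) (auto intro: card_image_le assms)

lemma num_components_ge:
  assumes "finite (\<Union>F)" "edge_constant F g"
  shows "card (g ` \<Union>F) \<le> num_components F"
  unfolding num_components_def by (rule Max_ge[OF finite_label_counts]) (use assms in auto)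

lemma num_components_attained:
  assumes "finite (\<Union>F)"
  obtains g where "edge_constant F g" "num_components F = card (g ` \<Union>F)"
proof -
  have "edge_constant F (\<lambda>_. 0)" by (simp add: edge_constant_def)
  then have "{card (g ` \<Union>F) | g. edge_constant F g} \<noteq> {}" by blast
  from Max_in[OF finite_label_counts[OF assms] this] show thesis
    using that unfolding num_components_def by blast
qed

text \<open>The components of \<open>missed F e\<close> touched by an edge of \<open>hit F e\<close> are merged, together with
  \<open>hit F e\<close>, into a single one.\<close>

lemma num_components_merge:
  assumes fin: "finite (\<Union>F)" and ne: "hit F e \<noteq> {}" and nemp: "{} \<notin> F"
    and g: "edge_constant (missed F e) g"
  shows "card (g ` \<Union>(missed F e)) + 1
    \<le> num_components F + card (g ` (\<Union>(hit F e) \<inter> \<Union>(missed F e)))"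
proof -
  define A where "A = g ` \<Union>(missed F e)"
  define L where "L = g ` (\<Union>(hit F e) \<inter> \<Union>(missed F e))"
  have F: "F = missed F e \<union> hit F e" by (auto simp: missed_def hit_def)
  then have UF: "\<Union>F = \<Union>(missed F e) \<union> \<Union>(hit F e)" by blast
  have finA: "finite A" using fin UF by (simp add: A_def)
  have LA: "L \<subseteq> A" by (auto simp: L_def A_def)
  \<comment> \<open>A fresh label for the merged component exists because labels are natural
    numbers.\<close>
  obtain z where z: "z \<notin> A" using finA ex_new_if_finite infinite_UNIV_nat by blast
  define g' where "g' y = (if y \<in> \<Union>(hit F e) \<or> g y \<in> L then z else g y)" for y
  have "edge_constant F g'"
    unfolding edge_constant_def
  proof (intro ballI)
    fix f x y assume f: "f \<in> F" "x \<in> f" "y \<in> f"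
    show "g' x = g' y"
    proof (cases "f \<in> hit F e")
      case True
      then show ?thesis using f by (auto simp: g'_def)
    next
      case False
      then have fm: "f \<in> missed F e" using f F by blast
      then have gxy: "g x = g y" using edge_constantD[OF g] f by blast
      \<comment> \<open>On a missed edge the first condition in \<open>g'\<close> implies the
        second, so \<open>g'\<close> depends only on \<open>g\<close> there.\<close>
      have L: "g v \<in> L" if "v \<in> f" "v \<in> \<Union>(hit F e)" for v
        using that fm by (auto simp: L_def)
      have "g' v = (if g v \<in> L then z else g v)" if "v \<in> f" for v
        using L[OF that] unfolding g'_def by argo
      then show ?thesis using f gxy by simp
    qed
  qed
  then have le: "card (g' ` \<Union>F) \<le> num_components F" using num_components_ge[OF fin] by blast
  \<comment> \<open>No label outside \<open>L\<close> is lost, and the hit edges, of which there is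
    at least one, provide \<open>z\<close>.\<close>
  have "insert z (A - L) \<subseteq> g' ` \<Union>F"
  proof
    fix l assume "l \<in> insert z (A - L)"
    then consider "l = z" | "l \<in> A" "l \<notin> L" by blast
    then show "l \<in> g' ` \<Union>F"
    proof cases
      case 1
      obtain f where f: "f \<in> hit F e" using ne by blast
      then obtain y where "y \<in> f" by (auto simp: hit_def)
      then have "y \<in> \<Union>(hit F e)" using f by blast
      then show ?thesis using 1 UF by (auto simp: g'_def intro!: image_eqI[of _ _ y])
    next
      case 2
      then obtain y where y: "y \<in> \<Union>(missed F e)" "l = g y" by (auto simp: A_def)
      then have "y \<notin> \<Union>(hit F e)" using 2 unfolding L_def by blast
      then have "g' y = l" using 2 y by (simp add: g'_def)
      then show ?thesis using y UF by blast
    qed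
  qed
  then have "card (insert z (A - L)) \<le> card (g' ` \<Union>F)"
    using fin by (intro card_mono) auto
  moreover have "card (insert z (A - L)) = card A - card L + 1"
    using finA LA z by (simp add: card_Diff_subset finite_subset[OF LA finA])
  moreover have "card L \<le> card A" using LA finA card_mono by blast
  ultimately show ?thesis using le unfolding A_def L_def by linarith
qed

section \<open>Potential drop caused by a single move\<close>

text \<open>The ends off \<open>e\<close> of the edges in \<open>S\<close> already account for every
  label shared by hit and missed edges. Each edge of \<open>S\<close> has at most one such end, so
  at most \<open>card S\<close> components replace the merged one, while
  \<open>card (hit F e)\<close> edges disappear. The premise ranges over all \<open>g\<close>
  because an optimal labelling is chosen inside the proof.\<close>

lemma potential_drop:
  assumes fin: "finite (\<Union>F)" and F2: "\<forall>f\<in>F. card f = 2"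
    and ne: "hit F e \<noteq> {}" and S: "S \<subseteq> hit F e"
    and cov: "\<And>g. edge_constant (missed F e) g
      \<Longrightarrow> g ` (\<Union>(hit F e) \<inter> \<Union>(missed F e)) \<subseteq> (\<Union>f\<in>S. g ` (f - e))"
  shows "potential (missed F e) + card (hit F e) + 1 \<le> potential F + card S"
proof -
  have finF: "finite F" using fin finite_UnionD by blast
  have F: "F = missed F e \<union> hit F e" "missed F e \<inter> hit F e = {}"
    by (auto simp: missed_def hit_def)
  have fins: "finite (missed F e)" "finite (hit F e)" using finF F by (metis finite_Un)+
  have finS: "finite S" using S fins finite_subset by blast
  have "finite (\<Union>(missed F e))" using fin by (rule rev_finite_subset) (auto simp: missed_def)
  then obtain g where g: "edge_constant (missed F e) g"
    "num_components (missed F e) = card (g ` \<Union>(missed F e))"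
    using num_components_attained by blast
  have one: "finite (f - e)" "card (f - e) \<le> 1" if "f \<in> S" for f
  proof -
    have f: "card f = 2" "f \<inter> e \<noteq> {}" using that S F2 by (auto simp: hit_def)
    then have ff: "finite f" using card.infinite by fastforce
    then show "finite (f - e)" by simp
    have "f - e \<subset> f" using f by blast
    then show "card (f - e) \<le> 1" using psubset_card_mono[OF ff, of "f - e"] f by simp
  qed
  have "card (g ` (\<Union>(hit F e) \<inter> \<Union>(missed F e))) \<le> card (\<Union>f\<in>S. g ` (f - e))"
    using cov[OF g(1)] finS one(1) by (intro card_mono) auto
  also have "\<dots> \<le> (\<Sum>f\<in>S. card (g ` (f - e)))" by (rule card_UN_le[OF finS])
  also have "\<dots> \<le> (\<Sum>f\<in>S. 1)"
    by (intro sum_mono) (use one card_image_le le_trans in blast)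
  finally have "card (g ` (\<Union>(hit F e) \<inter> \<Union>(missed F e))) \<le> card S" by simp
  moreover have "{} \<notin> F" using F2 by fastforce
  moreover have "card F = card (missed F e) + card (hit F e)"
    using card_Un_disjoint[OF fins F(2)] F(1) by simp
  ultimately show ?thesis
    using num_components_merge[OF fin ne _ g(1)] g(2) unfolding potential_def by linarith
qed

lemma hit_labels:
  "g ` (\<Union>(hit F e) \<inter> \<Union>(missed F e)) \<subseteq> (\<Union>f\<in>hit F e. g ` (f - e))"
  by (auto simp: missed_def)

text \<open>With \<open>S\<close> all of \<open>hit F e\<close>, the two cardinalities cancel and 1
  remains.\<close>

lemma potential_move:
  assumes "finite (\<Union>F)" "\<forall>f\<in>F. card f = 2" "hit F e \<noteq> {}"
  shows "potential (missed F e) + 1 \<le> potential F"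
  using potential_drop[OF assms subset_refl hit_labels] by linarith

text \<open>In a matching, hit and missed edges share no vertex, so the empty \<open>S\<close>
  serves and the drop is at least \<open>card (hit F e) + 1\<close>.\<close>

lemma potential_move_matching:
  assumes fin: "finite (\<Union>F)" and F2: "\<forall>f\<in>F. card f = 2" and ne: "hit F e \<noteq> {}"
    and disj: "pairwise disjnt F"
  shows "potential (missed F e) + 2 \<le> potential F"
proof -
  have "\<Union>(hit F e) \<inter> \<Union>(missed F e) = {}"
  proof (rule ccontr)
    assume "\<Union>(hit F e) \<inter> \<Union>(missed F e) \<noteq> {}"
    then obtain h k y where "h \<in> hit F e" "k \<in> missed F e" "y \<in> h" "y \<in> k" by blast
    moreover from this have "h \<in> F" "k \<in> F" "h \<noteq> k" by (auto simp: hit_def missed_def)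
    ultimately show False using pairwiseD[OF disj, of h k] by (auto simp: disjnt_def)
  qed
  then have "potential (missed F e) + card (hit F e) + 1 \<le> potential F + card ({} :: 'a set set)"
    by (intro potential_drop fin F2 ne) auto
  moreover have "finite (hit F e)" using fin by (rule finite_hit)
  then have "card (hit F e) \<ge> 1" using ne by (simp add: Suc_le_eq card_gt_0_iff)
  ultimately show ?thesis by simp
qed

section \<open>Longest paths and Dominator's move\<close>

lemma edges_walk_subset: "f \<in> set (walk_edges ws) \<Longrightarrow> f \<subseteq> set ws"
  by (induction ws rule: walk_edges.induct) auto

lemma vertices_walk_subset:
  assumes "2 \<le> length ws"
  shows "set ws \<subseteq> \<Union>(set (walk_edges ws))"
  using assms
proof (induction ws rule: walk_edges.induct)
  case (1 u v vs)
  then show ?case by (cases vs) auto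
qed auto

lemma card_2_other_end:
  assumes "card e = 2" "b \<in> e"
  obtains a where "e = {b, a}" "a \<noteq> b"
  using assms by (auto simp: card_2_iff)

text \<open>Two incident edges give a path on three vertices, so a longest one has at least three.
  Maximality is recorded only at the end \<open>v0\<close>: prepending a neighbour off the path
  would lengthen it.\<close>

lemma longest_path:
  assumes fin: "finite (\<Union>F)" and F2: "\<forall>f\<in>F. card f = 2" and nd: "\<not> pairwise disjnt F"
  obtains v0 v1 v2 ys where "distinct (v0 # v1 # v2 # ys)"
    "set (walk_edges (v0 # v1 # v2 # ys)) \<subseteq> F"
    "\<And>w. {v0, w} \<in> F \<Longrightarrow> w \<in> set (v1 # v2 # ys)"
proof -
  define P where "P xs \<longleftrightarrow> distinct xs \<and> set (walk_edges xs) \<subseteq> F" for xs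
  obtain e f where ef: "e \<in> F" "f \<in> F" "e \<noteq> f" "e \<inter> f \<noteq> {}"
    using nd by (auto simp: pairwise_def disjnt_def)
  then obtain b where b: "b \<in> e" "b \<in> f" by blast
  obtain a where a: "e = {b, a}" "a \<noteq> b"
    using card_2_other_end[of e b] F2 ef(1) b(1) by blast
  obtain c where c: "f = {b, c}" "c \<noteq> b"
    using card_2_other_end[of f b] F2 ef(2) b(2) by blast
  have "a \<noteq> c" using a c ef(3) by blast
  then have start: "P [a, b, c]" using a c ef(1,2) by (simp add: P_def insert_commute)
  \<comment> \<open>The summand 2 covers lists with fewer than two vertices, which need not lie
    inside \<open>\<Union>F\<close>.\<close>
  have "length xs < card (\<Union>F) + 2" if "P xs" for xs
  proof (cases "2 \<le> length xs")
    case True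
    then have "set xs \<subseteq> \<Union>(set (walk_edges xs))" by (rule vertices_walk_subset)
    also have "\<dots> \<subseteq> \<Union>F" using that unfolding P_def by blast
    finally have "set xs \<subseteq> \<Union>F" .
    then have "card (set xs) \<le> card (\<Union>F)" using fin card_mono by blast
    then show ?thesis using that by (simp add: P_def distinct_card)
  qed simp
  with start obtain xs where xs: "P xs" and max: "\<And>ys. P ys \<Longrightarrow> length ys \<le> length xs"
    using ex_has_greatest_nat[of P "[a, b, c]" length "card (\<Union>F) + 2"] by blast
  have "3 \<le> length xs" using max[OF start] by simp
  then obtain v0 v1 v2 ys where eq: "xs = v0 # v1 # v2 # ys"
    by (auto simp: numeral_3_eq_3 Suc_le_length_iff)
  show thesis
  proof (rule that)
    show "distinct (v0 # v1 # v2 # ys)" "set (walk_edges (v0 # v1 # v2 # ys)) \<subseteq> F"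
      using xs unfolding P_def eq by blast+
    fix w assume w: "{v0, w} \<in> F"
    show "w \<in> set (v1 # v2 # ys)"
    proof (rule ccontr)
      assume "w \<notin> set (v1 # v2 # ys)"
      moreover have "w \<noteq> v0" using w F2 by fastforce
      ultimately have "P (w # xs)" using xs w unfolding P_def eq by (auto simp: insert_commute)
      then show False using max[of "w # xs"] by simp
    qed
  qed
qed

lemma good_move:
  assumes fin: "finite (\<Union>F)" and F2: "\<forall>f\<in>F. card f = 2" and nd: "\<not> pairwise disjnt F"
  obtains e where "e \<in> F" "potential (missed F e) + 3 \<le> potential F"
proof -
  obtain v0 v1 v2 ys where d: "distinct (v0 # v1 # v2 # ys)"
    and walk: "set (walk_edges (v0 # v1 # v2 # ys)) \<subseteq> F"
    and max: "\<And>w. {v0, w} \<in> F \<Longrightarrow> w \<in> set (v1 # v2 # ys)"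
    using longest_path[OF assms] by metis
  define e where "e = {v1, v2}"
  define f where "f = {v0, v1}"
  have eF: "e \<in> F" and fF: "f \<in> F" using walk by (auto simp: e_def f_def)
  have R: "e \<in> hit F e" "f \<in> hit F e" "e \<noteq> f"
    using eF fF d by (auto simp: hit_def e_def f_def doubleton_eq_iff)
  \<comment> \<open>Omitting two edges from \<open>S\<close> is what raises the drop from 1 to
    3.\<close>
  define S where "S = hit F e - {e, f}"
  have cov: "g ` (\<Union>(hit F e) \<inter> \<Union>(missed F e)) \<subseteq> (\<Union>h\<in>S. g ` (h - e))"
    if g: "edge_constant (missed F e) g" for g
  proof
    fix l assume "l \<in> g ` (\<Union>(hit F e) \<inter> \<Union>(missed F e))"
    then obtain h y where h: "h \<in> hit F e" "y \<in> h" "y \<in> \<Union>(missed F e)" "l = g y" by blast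
    have ye: "y \<notin> e" using h by (auto simp: missed_def)
    show "l \<in> (\<Union>h\<in>S. g ` (h - e))"
    proof (cases "h = f")
      case False
      then have "h \<in> S" using h ye by (auto simp: S_def)
      then show ?thesis using h ye by blast
    next
      case True
      \<comment> \<open>The only end of \<open>f\<close> off \<open>e\<close> is \<open>v0\<close>.
        The missed edge at \<open>v0\<close> leads into the tail \<open>ys\<close>, so the label of
        \<open>v0\<close> is supplied by \<open>{v2, v3}\<close>, an edge of
        \<open>S\<close>.\<close>
      then have y: "y = v0" using h ye by (auto simp: f_def e_def)
      obtain k where k: "k \<in> missed F e" "v0 \<in> k" using h y by blast
      then have "k \<in> F" by (auto simp: missed_def)
      then obtain w where w: "k = {v0, w}" using card_2_other_end[of k v0] F2 k(2) by blast
      have "w \<in> set (v1 # v2 # ys)" using max \<open>k \<in> F\<close> w by blast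
      moreover have "w \<noteq> v1" "w \<noteq> v2" using k w by (auto simp: missed_def e_def)
      ultimately have wys: "w \<in> set ys" by simp
      then obtain v3 zs where ys: "ys = v3 # zs" by (cases ys) auto
      \<comment> \<open>By distinctness the tail avoids \<open>v1\<close> and \<open>v2\<close>, so
        \<open>g\<close> is constant along it.\<close>
      have "set (walk_edges ys) \<subseteq> missed F e"
      proof
        fix q assume q: "q \<in> set (walk_edges ys)"
        then have "q \<in> F" using walk ys by auto
        moreover have "q \<subseteq> set ys" using edges_walk_subset q by blast
        ultimately show "q \<in> missed F e" using d by (auto simp: missed_def e_def)
      qed
      then have "g w = g v3" using edge_constant_walk[OF g _ wys] ys by simp
      moreover have "g v0 = g w" using edge_constantD[OF g k(1)] w by blast
      moreover have "{v2, v3} \<in> S"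
        using walk d by (auto simp: S_def hit_def e_def f_def ys doubleton_eq_iff)
      moreover have "v3 \<in> {v2, v3} - e" using d ys by (auto simp: e_def)
      ultimately show ?thesis using h(4) y by (metis UN_I image_eqI)
    qed
  qed
  have finR: "finite (hit F e)" using fin by (rule finite_hit)
  have "card S = card (hit F e) - 2" using R finR by (simp add: S_def card_Diff_subset)
  \<comment> \<open>This makes the truncated subtraction of 2 exact.\<close>
  moreover have "card {e, f} \<le> card (hit F e)" using R finR by (intro card_mono) auto
  moreover have "potential (missed F e) + card (hit F e) + 1 \<le> potential F + card S"
    by (rule potential_drop[OF fin F2 _ _ cov]) (use R in \<open>auto simp: S_def\<close>)
  ultimately have "potential (missed F e) + 3 \<le> potential F" using R(3) by simp
  with eF that show thesis by blast
qed

section \<open>Bounding the length of the game\<close>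

lemma remaining_moves_bound:
  assumes fin: "finite (\<Union>E)" and E2: "\<forall>f\<in>E. card f = 2"
  shows "2 * remaining_moves E p D \<le> potential (undominated E D) +
    (if p = Staller \<and> \<not> pairwise disjnt (undominated E D) then 1 else 0)"
proof (induction "card (E - D)" arbitrary: p D rule: less_induct)
  case less
  define U where "U = undominated E D"
  have finE: "finite E" using fin finite_UnionD by blast
  have "U \<subseteq> E" by (auto simp: U_def undominated_def)
  then have finU: "finite (\<Union>U)" and U2: "\<forall>f\<in>U. card f = 2"
    using E2 by (auto intro: rev_finite_subset[OF fin])
  have IH: "2 * remaining_moves E q (insert e D) \<le> potential (missed U e) +
      (if q = Staller \<and> \<not> pairwise disjnt (missed U e) then 1 else 0)"
    if "e \<in> legal_moves E D" for e q
    using less[OF legal_move_decreases[OF finE that], of q] by (simp add: undominated_insert U_def)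
  have matching: "pairwise disjnt (missed U e)" if "pairwise disjnt U" for e
    using that by (rule pairwise_subset) (auto simp: missed_def)
  have finL: "finite (legal_moves E D)" using finE by (simp add: legal_moves_def)
  show ?case
  proof (cases "edge_dominating_set E D \<or> infinite E \<or> legal_moves E D = {}")
    case True
    then show ?thesis by (subst remaining_moves.simps) simp
  next
    case False
    note rec = remaining_moves.simps[of E p D, unfolded if_not_P[OF False]]
    show ?thesis
    proof (cases p)
      case Dominator
      obtain e where e: "e \<in> U" and drop: "potential (missed U e) +
          (if pairwise disjnt U then 2 else 3) \<le> potential U"
      proof (cases "pairwise disjnt U")
        case True
        from False obtain e0 where "hit U e0 \<noteq> {}"
          using legal_moves_iff_hit unfolding U_def by blast
        then obtain e where e: "e \<in> U" by (auto simp: hit_def)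
        then have "hit U e \<noteq> {}" using U2 by (force simp: hit_def)
        then show thesis using that[OF e] potential_move_matching[OF finU U2 _ True] True by simp
      next
        case False
        then show thesis using good_move[OF finU U2] that by auto
      qed
      have "hit U e \<noteq> {}" using e U2 by (force simp: hit_def)
      then have legal: "e \<in> legal_moves E D"
        using e \<open>U \<subseteq> E\<close> by (auto simp: legal_moves_iff_hit U_def)
      \<comment> \<open>One legal move bounds the minimum from above.\<close>
      have "remaining_moves E p D \<le> 1 + remaining_moves E Staller (insert e D)"
        using rec legal finL by (simp add: Dominator)
      then show ?thesis
        using IH[OF legal, of Staller] drop matching[of e]
        by (auto simp: Dominator U_def[symmetric] split: if_splits)
    next
      case Staller
      have "Max ((\<lambda>e. remaining_moves E Dominator (insert e D)) ` legal_moves E D)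
          \<in> (\<lambda>e. remaining_moves E Dominator (insert e D)) ` legal_moves E D"
        using finL False by (intro Max_in) auto
      then obtain e where legal: "e \<in> legal_moves E D"
        and eq: "remaining_moves E p D = 1 + remaining_moves E Dominator (insert e D)"
        using rec by (auto simp: Staller)
      have "hit U e \<noteq> {}" using legal by (simp add: legal_moves_iff_hit U_def)
      then show ?thesis
        using IH[OF legal, of Dominator] eq potential_move[OF finU U2]
          potential_move_matching[OF finU U2, of e]
        by (fastforce simp: Staller U_def[symmetric])
    qed
  qed
qed

text \<open>Every edge meets the trail, along which labels are constant, so at most one label
  occurs. The value is 0 when \<open>E\<close> is empty.\<close>

lemma num_components_edge_dominating_trail:
  assumes fin: "finite (\<Union>E)" and "edge_dominating_trail V E vs"
  shows "num_components E \<le> 1"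
proof -
  have walk: "set (walk_edges vs) \<subseteq> E" and cover: "\<forall>e\<in>E. e \<inter> set vs \<noteq> {}"
    using assms(2) by (auto simp: edge_dominating_trail_def trail_def vertex_cover_def)
  obtain g where g: "edge_constant E g" "num_components E = card (g ` \<Union>E)"
    using num_components_attained[OF fin] by blast
  have "g ` \<Union>E \<subseteq> {g (hd vs)}"
  proof (rule image_subsetI)
    fix x assume "x \<in> \<Union>E"
    then obtain e where e: "e \<in> E" "x \<in> e" by blast
    then obtain y where y: "y \<in> e" "y \<in> set vs" using cover by blast
    have "g x = g y" by (rule edge_constantD[OF g(1) e y(1)])
    also have "\<dots> = g (hd vs)" by (rule edge_constant_walk[OF g(1) walk y(2)])
    finally show "g x \<in> {g (hd vs)}" by simp
  qed
  then show ?thesis using g(2) card_mono[of "{g (hd vs)}" "g ` \<Union>E"] by simp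
qed

theorem theorem4p9:
  fixes V :: "'a set" and E :: "'a set set"
  assumes "simple_graph V E"
    and "\<exists>vs. edge_dominating_trail V E vs"
  shows "int (game_edge_domination_number E) \<le> \<lceil>real (card E) / 2\<rceil>"
proof -
  have fin: "finite (\<Union>E)" and E2: "\<forall>f\<in>E. card f = 2"
    using assms(1) by (auto simp: simple_graph_def intro: rev_finite_subset[of V])
  have "num_components E \<le> 1"
    using num_components_edge_dominating_trail[OF fin] assms(2) by blast
  then have "2 * game_edge_domination_number E \<le> card E + 1"
    using remaining_moves_bound[OF fin E2, of Dominator "{}"]
    by (simp add: game_edge_domination_number_def potential_def undominated_def)
  \<comment> \<open>The 1 contributed by the single component becomes the rounding up of half the
    edge count.\<close>
  then show ?thesis by linarith
qed

end
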